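(* Let $N \geq 1$ be an integer and let $\omega_1, \ldots, \omega_N, \varphi_1, \ldots, \varphi_N \in \mathbb{R}$. Assume there exist infinitely many integers $n$ such that, for any $i \in \{1, \ldots, N\}$, $n\omega_i + \varphi_i \not\equiv \frac{\pi}{2} \bmod \pi$. Then there exist real numbers $\varepsilon, \lambda > 0$ and an increasing function $\psi : \mathbb{N} \to \mathbb{N}$ such that $\lim_{n \to \infty} \frac{\psi(n)}{n} = \lambda$ and, for any $n \in \mathbb{N}$ and any $i \in \{1, \ldots, N\}$, $$|\cos(\psi(n)\omega_i + \varphi_i)| \geq \varepsilon.$$
   Context: For real $x,y$, the notation $x \equiv y \bmod \pi$ means $x - y \in \pi\mathbb{Z}$. "Increasing" means strictly increasing. *)

theory Defs
  imports "HOL-Analysis.Analysis" "HOL-Library.Real_Mod"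
begin

text \<open>
  The library relation \<open>[x = y] (rmod m)\<close> compares the remainders of \<open>x\<close> and \<open>y\<close> modulo \<open>m\<close>.
  For \<open>m = pi\<close> it says that \<open>x - y\<close> is an integer multiple of \<open>pi\<close>:
\<close>

lemma rcong_pi_iff: "[x = y] (rmod pi) \<longleftrightarrow> x - y \<in> (\<lambda>k. pi * k) ` \<int>"
proof -
  have "[x = y] (rmod pi) \<longleftrightarrow> (\<exists>k::int. x = y + of_int k * pi)"
    by (subst rcong_sym_iff) (simp add: rcong_altdef)
  also have "\<dots> \<longleftrightarrow> x - y \<in> (\<lambda>k. pi * k) ` \<int>"
    by (auto simp: Ints_def image_image algebra_simps image_iff)
  finally show ?thesis .
qed

end

theory Submission
  imports Defs
begin

text \<open>
  Call \<open>i\<close> rational if \<open>sin (q * \<omega> i) = 0\<close> for some \<open>q > 0\<close>, and let \<open>Q\<close> be a common such \<open>q\<close> for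
  all rational indices. Along a residue class modulo \<open>Q\<close>, the value of
  \<open>\<bar>cos (n * \<omega> i + \<phi> i)\<bar>\<close> is constant for rational \<open>i\<close>, and it is nonzero on the class of any
  single admissible integer. For the other indices, \<open>\<bar>sin (x - y)\<bar> \<le> \<bar>cos x\<bar> + \<bar>cos y\<bar>\<close> shows
  that, once \<open>\<epsilon>\<close> is small enough, each of them excludes at most one of any \<open>N + 1\<close> consecutive
  members of the class. Hence every such window contains a good integer, and
  picking one from each window gives a sequence of slope \<open>Q * (N + 1)\<close>.
\<close>

lemma finite_pos_lower_bound:
  fixes f :: "'a \<Rightarrow> real"
  assumes "finite A" "\<And>a. a \<in> A \<Longrightarrow> f a > 0"
  shows "\<exists>e>0. \<forall>a\<in>A. e \<le> f a"
  \<comment> \<open>Inserting 1 keeps the minimum well defined and positive when \<open>A\<close> is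
    empty.\<close>
  using assms by (intro exI[of _ "Min (insert 1 (f ` A))"]) auto

lemma abs_sin_diff_le: "\<bar>sin (x - y)\<bar> \<le> \<bar>cos x\<bar> + \<bar>cos y\<bar>" for x y :: real
proof -
  have "\<bar>sin x * cos y\<bar> \<le> \<bar>cos y\<bar>"
    unfolding abs_mult by (intro mult_left_le_one_le) auto
  moreover have "\<bar>cos x * sin y\<bar> \<le> \<bar>cos x\<bar>"
    unfolding abs_mult by (intro mult_left_le) auto
  ultimately show ?thesis
    unfolding sin_diff by linarith
qed

text \<open>The zeros of sine form the group \<pi>Z. The factor is an integer, not a natural number,
  because the shift away from \<open>n\<^sub>0\<close> in the main proof can be negative.\<close>

lemma sin_int_mult_eq_0:
  fixes y :: real
  assumes "sin y = 0"
  shows "sin (of_int m * y) = 0"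
proof -
  obtain j :: int where "y = of_int j * pi"
    using assms by (auto simp: sin_zero_iff_int2)
  then have "of_int m * y = of_int (m * j) * pi"
    by simp
  then show ?thesis
    unfolding sin_zero_iff_int2 by blast
qed

lemma abs_cos_add_eq:
  fixes x y :: real
  assumes "sin y = 0"
  shows "\<bar>cos (x + y)\<bar> = \<bar>cos x\<bar>"
proof -
  have "\<bar>cos y\<bar> = 1"
    using assms sin_zero_abs_cos_one by blast
  then show ?thesis
    using assms by (simp add: cos_add abs_mult)
qed

text \<open>The product of the individual periods serves, since a multiple of a period is again a
  period.\<close>

lemma common_period:
  fixes \<omega> :: "'a \<Rightarrow> real"
  assumes "finite R" "\<And>i. i \<in> R \<Longrightarrow> \<exists>q::nat. q > 0 \<and> sin (real q * \<omega> i) = 0"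
  shows "\<exists>Q::nat. Q > 0 \<and> (\<forall>i\<in>R. sin (real Q * \<omega> i) = 0)"
  using assms
proof (induction R rule: finite_induct)
  case empty
  show ?case by (intro exI[of _ 1]) auto
next
  case (insert a R)
  then obtain Q :: nat where Q: "Q > 0" "\<forall>i\<in>R. sin (real Q * \<omega> i) = 0"
    by auto
  obtain q :: nat where q: "q > 0" "sin (real q * \<omega> a) = 0"
    using insert.prems by blast
  have "sin (real (q * Q) * \<omega> i) = 0" if "i \<in> insert a R" for i
  proof (cases "i = a")
    case True
    then show ?thesis
      using sin_int_mult_eq_0[OF q(2), of "int Q"] by (simp add: mult_ac)
  next
    case False
    then have "sin (real Q * \<omega> i) = 0"
      using Q(2) that by blast
    from sin_int_mult_eq_0[OF this, of "int q"] show ?thesis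
      by (simp add: mult_ac)
  qed
  then show ?case
    using Q(1) q(1) by (intro exI[of _ "q * Q"]) auto
qed

text \<open>Pigeonhole: if each of the \<open>card I + 1\<close> members of the window were spoilt
  by some index, two of them would share that index. Their distance lies in
  \<open>{1..card I}\<close>, and two cosines below \<open>\<epsilon>\<close> force the sine of the
  difference of their arguments below \<open>2 * \<epsilon>\<close>, against
  \<open>sep\<close>.\<close>

lemma good_index_in_window:
  fixes \<theta> \<phi> :: "'a \<Rightarrow> real"
  assumes "finite I"
    and sep: "\<And>i m. \<lbrakk>i \<in> I; m \<in> {1..card I}\<rbrakk> \<Longrightarrow> 2 * \<epsilon> \<le> \<bar>sin (real m * \<theta> i)\<bar>"
  shows "\<exists>k\<in>{K..K + card I}. \<forall>i\<in>I. \<epsilon> \<le> \<bar>cos (real k * \<theta> i + \<phi> i)\<bar>"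
proof (rule ccontr)
  assume "\<not> ?thesis"
  then have "\<forall>k\<in>{K..K + card I}. \<exists>i\<in>I. \<bar>cos (real k * \<theta> i + \<phi> i)\<bar> < \<epsilon>"
    by (meson not_le)
  then obtain f where f: "\<And>k. k \<in> {K..K + card I} \<Longrightarrow> f k \<in> I"
    "\<And>k. k \<in> {K..K + card I} \<Longrightarrow> \<bar>cos (real k * \<theta> (f k) + \<phi> (f k))\<bar> < \<epsilon>"
    by metis
  have "card (f ` {K..K + card I}) \<le> card I"
    using f(1) assms(1) by (intro card_mono) auto
  then have "\<not> inj_on f {K..K + card I}"
    by (intro pigeonhole) simp
  then obtain k l where kl: "k \<in> {K..K + card I}" "l \<in> {K..K + card I}" "k < l" "f k = f l"
    unfolding inj_on_def by (metis linorder_neqE_nat)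
  have "2 * \<epsilon> \<le> \<bar>sin (real (l - k) * \<theta> (f l))\<bar>"
    using kl f(1) by (intro sep) auto
  also have "\<dots> = \<bar>sin ((real l * \<theta> (f l) + \<phi> (f l)) - (real k * \<theta> (f l) + \<phi> (f l)))\<bar>"
    using kl(3) by (simp add: algebra_simps)
  also have "\<dots> \<le> \<bar>cos (real l * \<theta> (f l) + \<phi> (f l))\<bar> + \<bar>cos (real k * \<theta> (f l) + \<phi> (f l))\<bar>"
    by (rule abs_sin_diff_le)
  also have "\<dots> < \<epsilon> + \<epsilon>"
    using f(2)[OF kl(1)] f(2)[OF kl(2)] kl(4) by (intro add_strict_mono) simp_all
  finally show False by simp
qed

lemma cos_eq_0_iff_rcong: "cos x = 0 \<longleftrightarrow> [x = pi / 2] (rmod pi)"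
proof -
  have "[x = pi / 2] (rmod pi) \<longleftrightarrow> (\<exists>k::int. x = pi / 2 + of_int k * pi)"
    by (subst rcong_sym_iff) (simp add: rcong_altdef)
  then show ?thesis
    by (simp add: cos_zero_iff_int2 add.commute)
qed

text \<open>The windows are disjoint and consecutive, which gives monotonicity. Within its window
  \<open>k n\<close> exceeds \<open>n * Suc N\<close> by at most \<open>N\<close>, so the quotient
  is off by at most a constant over \<open>n\<close>.\<close>

lemma slope_of_window_selection:
  fixes k :: "nat \<Rightarrow> nat"
  assumes "Q > 0" "\<And>n. k n \<in> {n * Suc N..n * Suc N + N}"
  shows "strict_mono (\<lambda>n. a + Q * k n)"
    and "(\<lambda>n. real (a + Q * k n) / real n) \<longlonglongrightarrow> real (Q * Suc N)"
proof -
  have bounds: "n * Suc N \<le> k n" "k n \<le> n * Suc N + N" for n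
    using assms(2)[of n] by auto
  have "k n < k (Suc n)" for n
    using bounds(2)[of n] bounds(1)[of "Suc n"] by simp
  then show "strict_mono (\<lambda>n. a + Q * k n)"
    using assms(1) by (simp add: strict_mono_Suc_iff)
  \<comment> \<open>At \<open>n = 0\<close> the quotient is 0 by convention and this bound fails;
    the limit needs it only eventually.\<close>
  have lower: "real (Q * Suc N) \<le> real (a + Q * k n) / real n" if "n > 0" for n
  proof -
    have "Q * (n * Suc N) \<le> a + Q * k n"
      using bounds(1)[of n] by (meson mult_le_mono2 trans_le_add2)
    then have "real (Q * (n * Suc N)) \<le> real (a + Q * k n)"
      by (simp only: of_nat_le_iff)
    then show ?thesis
      using that by (simp add: field_simps)
  qed
  have upper: "real (a + Q * k n) / real n \<le> real (Q * Suc N) + real (a + Q * N) / real n"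
    if "n > 0" for n
  proof -
    have "a + Q * k n \<le> a + Q * (n * Suc N + N)"
      using bounds(2)[of n] by (meson mult_le_mono2 add_left_mono)
    then have "real (a + Q * k n) \<le> real (a + Q * (n * Suc N + N))"
      by (simp only: of_nat_le_iff)
    then have "real (a + Q * k n) / real n \<le> real (a + Q * (n * Suc N + N)) / real n"
      by (intro divide_right_mono) auto
    also have "\<dots> = real (Q * Suc N) + real (a + Q * N) / real n"
      using that by (simp add: field_simps)
    finally show ?thesis .
  qed
  show "(\<lambda>n. real (a + Q * k n) / real n) \<longlonglongrightarrow> real (Q * Suc N)"
  proof (rule tendsto_sandwich)
    show "(\<lambda>n. real (Q * Suc N)) \<longlonglongrightarrow> real (Q * Suc N)"
      by simp
    show "(\<lambda>n. real (Q * Suc N) + real (a + Q * N) / real n) \<longlonglongrightarrow> real (Q * Suc N)"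
      using tendsto_add[OF tendsto_const[of "real (Q * Suc N)"] lim_const_over_n[of "real (a + Q * N)"]]
      by (simp only: add_0_right)
    show "\<forall>\<^sub>F n in sequentially. real (Q * Suc N) \<le> real (a + Q * k n) / real n"
      using eventually_gt_at_top[of 0] by eventually_elim (rule lower)
    show "\<forall>\<^sub>F n in sequentially.
        real (a + Q * k n) / real n \<le> real (Q * Suc N) + real (a + Q * N) / real n"
      using eventually_gt_at_top[of 0] by eventually_elim (rule upper)
  qed
qed

theorem proposition1:
  fixes N :: nat and \<omega> \<phi> :: "nat \<Rightarrow> real"
  assumes "N \<ge> 1"
    and "infinite {n :: int. \<forall>i\<in>{1..N}. \<not> [of_int n * \<omega> i + \<phi> i = pi / 2] (rmod pi)}"
  shows "\<exists>(\<epsilon> :: real) (l :: real) (\<psi> :: nat \<Rightarrow> nat).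
           \<epsilon> > 0 \<and> l > 0 \<and> strict_mono \<psi> \<and>
           (\<lambda>n. real (\<psi> n) / real n) \<longlonglongrightarrow> l \<and>
           (\<forall>n. \<forall>i\<in>{1..N}. \<bar>cos (real (\<psi> n) * \<omega> i + \<phi> i)\<bar> \<ge> \<epsilon>)"
proof -
  obtain n\<^sub>0 :: int where n0: "\<And>i. i \<in> {1..N} \<Longrightarrow> cos (of_int n\<^sub>0 * \<omega> i + \<phi> i) \<noteq> 0"
    using infinite_imp_nonempty[OF assms(2)] unfolding cos_eq_0_iff_rcong by blast
  define R where "R = {i \<in> {1..N}. \<exists>q::nat. q > 0 \<and> sin (real q * \<omega> i) = 0}"
  define I where "I = {1..N} - R"
  have fin: "finite R" "finite I"
    by (simp_all add: R_def I_def)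
  have card_I: "card I \<le> N"
    using card_mono[of "{1..N}" I] by (simp add: I_def)
  obtain Q :: nat where Q: "Q > 0" "\<And>i. i \<in> R \<Longrightarrow> sin (real Q * \<omega> i) = 0"
    using common_period[OF fin(1), of \<omega>] unfolding R_def by blast
  \<comment> \<open>\<open>n\<^sub>0\<close> may be negative; its residue modulo \<open>Q\<close> is
    a natural number in the same class.\<close>
  define a where "a = nat (n\<^sub>0 mod int Q)"
  have a: "int a = n\<^sub>0 - int Q * (n\<^sub>0 div int Q)"
    using Q(1) by (simp add: a_def minus_mult_div_eq_mod)
  have "\<exists>e>0. \<forall>i\<in>R. e \<le> \<bar>cos (of_int n\<^sub>0 * \<omega> i + \<phi> i)\<bar>"
    using n0 by (intro finite_pos_lower_bound fin) (auto simp: R_def)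
  then obtain e1 where e1: "e1 > 0" "\<And>i. i \<in> R \<Longrightarrow> e1 \<le> \<bar>cos (of_int n\<^sub>0 * \<omega> i + \<phi> i)\<bar>"
    by blast
  \<comment> \<open>A zero here would make \<open>m * Q\<close> a period of an index outside
    \<open>R\<close>. Only finitely many pairs occur, so the positive values have a uniform lower
    bound.\<close>
  have "\<exists>e>0. \<forall>p \<in> I \<times> {1..card I}. e \<le> \<bar>sin (real (snd p) * (real Q * \<omega> (fst p)))\<bar>"
  proof (rule finite_pos_lower_bound)
    fix p assume p: "p \<in> I \<times> {1..card I}"
    then have "fst p \<in> I" "snd p * Q > 0"
      using Q(1) by auto
    then have "sin (real (snd p * Q) * \<omega> (fst p)) \<noteq> 0"
      unfolding I_def R_def by blast
    then show "\<bar>sin (real (snd p) * (real Q * \<omega> (fst p)))\<bar> > 0"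
      by (simp add: mult.assoc)
  qed (use fin in auto)
  then obtain e2 where e2: "e2 > 0"
    "\<And>i m. \<lbrakk>i \<in> I; m \<in> {1..card I}\<rbrakk> \<Longrightarrow> e2 \<le> \<bar>sin (real m * (real Q * \<omega> i))\<bar>"
    by force
  \<comment> \<open>\<open>e1\<close> handles the indices in \<open>R\<close>; \<open>e2\<close> is
    halved because the sine is bounded by a sum of two cosines.\<close>
  define \<epsilon> where "\<epsilon> = min e1 (e2 / 2)"
  have "\<exists>k\<in>{n * Suc N..n * Suc N + N}.
      \<forall>i\<in>I. \<epsilon> \<le> \<bar>cos (real k * (real Q * \<omega> i) + (real a * \<omega> i + \<phi> i))\<bar>" for n
  proof -
    have "2 * \<epsilon> \<le> \<bar>sin (real m * (real Q * \<omega> i))\<bar>" if "i \<in> I" "m \<in> {1..card I}" for i m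
      using e2(2)[OF that] by (simp add: \<epsilon>_def)
    moreover have "{n * Suc N..n * Suc N + card I} \<subseteq> {n * Suc N..n * Suc N + N}"
      using card_I by simp
    ultimately show ?thesis
      using good_index_in_window[OF fin(2), of \<epsilon> "\<lambda>i. real Q * \<omega> i" "n * Suc N" "\<lambda>i. real a * \<omega> i + \<phi> i"]
      by blast
  qed
  then obtain k where k: "\<And>n. k n \<in> {n * Suc N..n * Suc N + N}"
    "\<And>n i. i \<in> I \<Longrightarrow> \<epsilon> \<le> \<bar>cos (real (k n) * (real Q * \<omega> i) + (real a * \<omega> i + \<phi> i))\<bar>"
    by metis
  have "\<epsilon> \<le> \<bar>cos (real (a + Q * k n) * \<omega> i + \<phi> i)\<bar>" if i: "i \<in> {1..N}" for n i
  proof (cases "i \<in> R")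
    case True
    \<comment> \<open>The signed number of steps of length \<open>Q\<close> leading from
      \<open>n\<^sub>0\<close> to \<open>a + Q * k n\<close>; each step changes the cosine at most
      in sign.\<close>
    define m where "m = int (k n) - n\<^sub>0 div int Q"
    have "int (a + Q * k n) = n\<^sub>0 + int Q * m"
      using a by (simp add: m_def algebra_simps)
    then have "real (a + Q * k n) = of_int n\<^sub>0 + real Q * of_int m"
      by (metis of_int_add of_int_mult of_int_of_nat_eq)
    then have "real (a + Q * k n) * \<omega> i + \<phi> i
        = (of_int n\<^sub>0 * \<omega> i + \<phi> i) + of_int m * (real Q * \<omega> i)"
      by (simp add: algebra_simps)
    then have "\<bar>cos (real (a + Q * k n) * \<omega> i + \<phi> i)\<bar> = \<bar>cos (of_int n\<^sub>0 * \<omega> i + \<phi> i)\<bar>"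
      by (simp only: abs_cos_add_eq[OF sin_int_mult_eq_0[OF Q(2)[OF True]]])
    then show ?thesis
      using e1(2)[OF True] by (simp add: \<epsilon>_def)
  next
    case False
    then show ?thesis
      using k(2)[of i n] i by (simp add: I_def algebra_simps)
  qed
  moreover have "\<epsilon> > 0"
    using e1(1) e2(1) by (simp add: \<epsilon>_def)
  moreover have "real (Q * Suc N) > 0"
    using Q(1) by (simp only: of_nat_0_less_iff) simp
  ultimately show ?thesis
    using slope_of_window_selection[OF Q(1) k(1), of a]
    by (intro exI[of _ \<epsilon>] exI[of _ "real (Q * Suc N)"] exI[of _ "\<lambda>n. a + Q * k n"] conjI ballI allI)
qed

end
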